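(* Let $N_f$ be an odd positive integer and put $\tilde N_f = N_f + 1$. Consider a sequence of networks $G_1, G_2, \dots$ with node counts $N_k = N_{k-1}+1$ for $k \ge 2$, where $N_f < N_k - 2$ for all $k$. Together with the networks, maintain an auxiliary cycle $C_k$ whose node set is the node set of $G_k$ ($C_k$ is bookkeeping only; its links are not necessarily links of $G_k$). Let $G_1$ be the network on the $N_1$ nodes of $C_1$ in which every node is linked to every node within distance $\tilde N_f/2$ along $C_1$. For $k \ge 2$, obtain $G_k$ from $G_{k-1}$ as follows: (i) form $C_k$ from $C_{k-1}$ by inserting the new node between any two adjacent nodes of $C_{k-1}$; (ii) link the new node to all nodes within distance $\tilde N_f/2$ of it along $C_k$; no other links are added or removed. Then $G_i$ is a subnetwork of $G_j$ for all $i \le j$, every $G_k$ is $N_f$-robust, and the number of links $L_k$ of $G_k$ satisfies $L_k \le N_k(N_f+1)$.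
   Context: A network is a finite simple undirected graph; links are edges. For an integer $N_f$, a network $G$ is $N_f$-robust if for every set $S$ of $N_f$ nodes of $G$, the network obtained by deleting the nodes of $S$ and their incident links is connected. The distance along a cycle between two of its nodes is the number of edges of the shorter of the two paths in the cycle between them. *)

theory Defs
  imports "Graph_Theory.Graph_Theory"
begin

text \<open>
  A finite simple undirected graph is a \<^locale>\<open>pair_graph\<close>: finite, loop-free, with a
  symmetric set of arcs. A link is a pair of opposite arcs, so it is counted as the
  two-element set of its end points.
\<close>

definition links :: "'a pair_pre_digraph \<Rightarrow> 'a set set" where
  "links G = {{u, v} | u v. (u, v) \<in> parcs G}"

definition robust :: "nat \<Rightarrow> 'a pair_pre_digraph \<Rightarrow> bool" where
  "robust Nf G \<longleftrightarrow>
     (\<forall>S. S \<subseteq> pverts G \<and> card S = Nf \<longrightarrow>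
        Digraph_Component.connected (with_proj G \<restriction> (pverts G - S)))"

text \<open>
  The library predicate \<^const>\<open>pre_digraph.cycle\<close> on arc lists admits going back and forth along
  one link; the length bound excludes this.
\<close>

definition cycle_graph :: "'a pair_pre_digraph \<Rightarrow> bool" where
  "cycle_graph C \<longleftrightarrow> pair_graph C \<and>
     (\<exists>p. pre_digraph.cycle (with_proj C) p \<and> 3 \<le> length p \<and>
          pverts C = fst ` set p \<and> parcs C = set p \<union> (set p)\<inverse>)"

text \<open>
  Between two distinct nodes of a cycle there are exactly two paths (walks without repeated
  nodes); between a node and itself only the empty one.
\<close>

definition cycle_dist :: "'a pair_pre_digraph \<Rightarrow> 'a \<Rightarrow> 'a \<Rightarrow> nat" where
  "cycle_dist C u v = (LEAST n. \<exists>p. pre_digraph.apath (with_proj C) u p v \<and> length p = n)"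

definition near :: "nat \<Rightarrow> 'a pair_pre_digraph \<Rightarrow> 'a \<Rightarrow> 'a set" where
  "near d C u = {v \<in> pverts C. v \<noteq> u \<and> cycle_dist C u v \<le> d}"

definition ring_network :: "nat \<Rightarrow> 'a pair_pre_digraph \<Rightarrow> 'a pair_pre_digraph" where
  "ring_network d C =
     \<lparr> pverts = pverts C, parcs = {(u, v). u \<in> pverts C \<and> v \<in> near d C u} \<rparr>"

text \<open>
  Inserting a node \<open>x\<close> between the adjacent nodes \<open>a\<close> and \<open>b\<close> of the cycle is the subdivision
  of the link between \<open>a\<close> and \<open>b\<close>.
\<close>

definition growth_step ::
  "nat \<Rightarrow> 'a pair_pre_digraph \<Rightarrow> 'a pair_pre_digraph \<Rightarrow>
     'a pair_pre_digraph \<Rightarrow> 'a pair_pre_digraph \<Rightarrow> bool" where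
  "growth_step d C G C' G' \<longleftrightarrow>
     (\<exists>x a b. x \<notin> pverts C \<and> (a, b) \<in> parcs C \<and> C' = subdivide C (a, b) x \<and>
        G' = \<lparr> pverts = insert x (pverts G),
               parcs = parcs G \<union> {x} \<times> near d C' x \<union> near d C' x \<times> {x} \<rparr>)"

end

theory Submission
  imports Defs
begin

text \<open>
  With \<open>2d = N\<^sub>f + 1\<close>, every network of the sequence stays connected under the deletion of fewer
  than \<open>2d\<close> nodes. In the initial ring network two surviving nodes cut the cycle into two arcs;
  one of them contains fewer than \<open>d\<close> deleted nodes, so consecutive survivors on it are at distance
  at most \<open>d\<close> and hence linked. Each further node is attached to exactly \<open>2d\<close> old nodes, one of
  which survives; this preserves the property and adds only \<open>2d\<close> links.

  Cycles are handled through periodic enumerations of their nodes by the integers, in which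
  nearness is a bound on the difference of indices.
\<close>

section \<open>Connectivity after deletion of nodes\<close>

text \<open>Unlike in \<open>robust\<close>, all sizes below the bound are covered and
  \<open>S\<close> may contain nodes outside \<open>G\<close>. Both matter when a node is attached:
  a deleted set of the larger network can then be used unchanged for the smaller one.\<close>

definition deletion_connected :: "nat \<Rightarrow> 'a pair_pre_digraph \<Rightarrow> bool" where
  "deletion_connected m G \<longleftrightarrow>
     (\<forall>S. finite S \<and> card S < m \<longrightarrow>
        (\<forall>u\<in>pverts G - S. \<forall>v\<in>pverts G - S. (u, v) \<in> (Restr (parcs G) (pverts G - S))\<^sup>*))"

text \<open>Library connectedness is strong connectedness of the symmetric closure, including
  nonemptiness. The closure contains all arcs of the restriction, so walks carry over.\<close>

lemma connected_induce_subgraphI: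
  assumes "W \<noteq> {}" "\<And>u v. u \<in> W \<Longrightarrow> v \<in> W \<Longrightarrow> (u, v) \<in> (Restr (parcs G) W)\<^sup>*"
  shows "Digraph_Component.connected (with_proj G \<restriction> W)"
proof -
  let ?H = "with_proj (mk_symmetric (with_proj G \<restriction> W))"
  have "u \<rightarrow>\<^sup>*\<^bsub>?H\<^esub> v" if "u \<in> W" "v \<in> W" for u v
    using assms(2)[OF that] that
  proof (induction rule: rtrancl_induct)
    case base
    then show ?case by (simp add: reachable_def)
  next
    case (step v w)
    then have "u \<rightarrow>\<^sup>*\<^bsub>?H\<^esub> v" by simp
    moreover have "(v, w) \<in> parcs (mk_symmetric (with_proj G \<restriction> W))"
      using step by (auto simp: parcs_mk_symmetric arcs_ends_conv)
    ultimately show ?case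
      using step.prems unfolding reachable_def by (auto intro: rtrancl_on_into_rtrancl_on)
  qed
  then show ?thesis
    using assms(1) by (simp add: Digraph_Component.connected_def strongly_connected_def)
qed

lemma robust_of_deletion_connected:
  assumes "deletion_connected (Nf + 1) G" "finite (pverts G)" "Nf < card (pverts G)"
  shows "robust Nf G"
  unfolding robust_def
proof (intro allI impI, elim conjE)
  fix S assume S: "S \<subseteq> pverts G" "card S = Nf"
  then have "finite S" using assms(2) by (auto intro: finite_subset)
  moreover have "pverts G - S \<noteq> {}" using S assms(3) by auto
  ultimately show "Digraph_Component.connected (with_proj G \<restriction> (pverts G - S))"
    using S assms(1) by (intro connected_induce_subgraphI) (simp_all add: deletion_connected_def)
qed

section \<open>Attaching a node\<close>

text \<open>The network half of a growth step, with an arbitrary neighbour set \<open>T\<close>; the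
  cycle enters only through facts about \<open>T\<close>.\<close>

definition attach :: "'a \<Rightarrow> 'a set \<Rightarrow> 'a pair_pre_digraph \<Rightarrow> 'a pair_pre_digraph" where
  "attach x T G = \<lparr> pverts = insert x (pverts G), parcs = parcs G \<union> {x} \<times> T \<union> T \<times> {x} \<rparr>"

text \<open>Fewer than \<open>m\<close> deletions cannot exhaust \<open>T\<close>, so some old
  neighbour \<open>t\<close> survives. It serves as a hub: old survivors are joined to it within
  \<open>G\<close>, and \<open>x\<close>, if it survives, by a link.\<close>

lemma deletion_connected_attach:
  assumes G: "deletion_connected m G" and T: "T \<subseteq> pverts G" "m \<le> card T"
  shows "deletion_connected m (attach x T G)"
  unfolding deletion_connected_def
proof (intro allI impI, elim conjE)
  fix S :: "'a set" assume S: "finite S" "card S < m"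
  let ?W = "pverts G - S" and ?W' = "pverts (attach x T G) - S"
  let ?R = "Restr (parcs G) ?W" and ?R' = "Restr (parcs (attach x T G)) ?W'"
  have "?R \<subseteq> ?R'" by (auto simp: attach_def)
  then have old: "(u, v) \<in> ?R'\<^sup>*" if "u \<in> ?W" "v \<in> ?W" for u v
    using G S that rtrancl_mono[of ?R ?R'] unfolding deletion_connected_def by blast
  have "\<not> T \<subseteq> S" using S T(2) card_mono[of S T] by auto
  then obtain t where t: "t \<in> T" "t \<in> ?W" using T(1) by auto
  have new: "(x, t) \<in> ?R'" "(t, x) \<in> ?R'" if "x \<notin> S"
    using t that by (auto simp: attach_def)
  have via: "(u, t) \<in> ?R'\<^sup>* \<and> (t, u) \<in> ?R'\<^sup>*" if "u \<in> ?W'" for u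
    using that old[of u t] old[of t u] t(2) new by (cases "u = x") (auto simp: attach_def)
  show "\<forall>u\<in>?W'. \<forall>v\<in>?W'. (u, v) \<in> ?R'\<^sup>*"
    using via by (meson rtrancl_trans)
qed

lemma card_links_attach:
  assumes "finite (links G)" "finite T"
  shows "card (links (attach x T G)) \<le> card (links G) + card T"
proof -
  have "links (attach x T G) \<subseteq> links G \<union> (\<lambda>t. {x, t}) ` T"
    by (auto simp: links_def attach_def)
  then have "card (links (attach x T G)) \<le> card (links G \<union> (\<lambda>t. {x, t}) ` T)"
    using assms by (intro card_mono) auto
  also have "\<dots> \<le> card (links G) + card T"
    using card_Un_le[of "links G" "(\<lambda>t. {x, t}) ` T"] card_image_le[OF assms(2), of "\<lambda>t. {x, t}"]
    by linarith
  finally show ?thesis .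
qed

lemma finite_links: "finite (parcs G) \<Longrightarrow> finite (links G)"
  by (rule finite_subset[of _ "(\<lambda>(u, v). {u, v}) ` parcs G"]) (auto simp: links_def)

lemma growth_step_attachE:
  assumes "growth_step d C G C' G'"
  obtains x a b where "x \<notin> pverts C" "(a, b) \<in> parcs C" "C' = subdivide C (a, b) x"
    "G' = attach x (near d C' x) G"
  using assms unfolding growth_step_def attach_def by blast

text \<open>Reduces the arcs of a cycle to one period, from which a single link can be split
  off.\<close>

lemma UN_periodic:
  fixes h :: "int \<Rightarrow> 'b set"
  assumes "0 < m" "\<And>i. h i = h (i mod m)"
  shows "(\<Union>i. h i) = (\<Union>i\<in>{0..<m}. h i)"
proof -
  have "i mod m \<in> {0..<m}" for i using assms(1) by simp
  then show ?thesis using assms(2) by blast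
qed

section \<open>Periodic enumerations of a cycle\<close>

text \<open>\<open>f\<close> wraps the integer line around the cycle. With integer indices, rotation
  and reflection are changes of index, and steps in either direction are signed
  displacements.\<close>

locale cyclic_enumeration =
  fixes C :: "'a pair_pre_digraph" and n :: nat and f :: "int \<Rightarrow> 'a"
  assumes eq_iff: "f i = f j \<longleftrightarrow> i mod int n = j mod int n"
    and verts_eq: "pverts C = range f"
    and arcs_eq: "parcs C = (\<Union>i. {(f i, f (i + 1)), (f (i + 1), f i)})"
    and three_le: "3 \<le> n"
begin

lemma eq_iff_dvd: "f i = f j \<longleftrightarrow> int n dvd i - j"
  by (simp add: eq_iff mod_eq_dvd_iff)

lemma f_mod: "f (i mod int n) = f i"
  by (simp add: eq_iff)

lemma inj_on_atLeastLessThan: "b \<le> a + int n \<Longrightarrow> inj_on f {a..<b}"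
proof (rule inj_onI)
  fix i j
  assume b: "b \<le> a + int n" and ij: "i \<in> {a..<b}" "j \<in> {a..<b}" "f i = f j"
  then have "int n dvd i - j" by (simp add: eq_iff_dvd)
  moreover have "\<bar>i - j\<bar> < int n" using b ij by auto
  ultimately show "i = j" using dvd_imp_le_int[of "i - j" "int n"] by linarith
qed

lemma verts_eq_image: "pverts C = f ` {a..<a + int n}"
proof -
  have "f i \<in> f ` {a..<a + int n}" for i
  proof -
    \<comment> \<open>The witness is the representative of \<open>i\<close> modulo \<open>n\<close>
      in the window starting at \<open>a\<close>.\<close>
    have "f (a + (i - a) mod int n) = f i"
      by (simp add: eq_iff mod_add_right_eq)
    moreover have "a + (i - a) mod int n \<in> {a..<a + int n}"
      using three_le by simp
    ultimately show ?thesis by (metis imageI)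
  qed
  then show ?thesis by (auto simp: verts_eq)
qed

lemma card_verts: "card (pverts C) = n"
  by (simp add: verts_eq_image[of 0] card_image inj_on_atLeastLessThan)

lemma finite_verts: "finite (pverts C)"
  by (simp add: verts_eq_image[of 0])

lemma shift: "cyclic_enumeration C n (\<lambda>i. f (i + t))"
proof
  show "pverts C = range (\<lambda>i. f (i + t))"
    unfolding verts_eq by (auto simp: image_iff) (metis diff_add_cancel)
  have "(\<Union>i. {(f i, f (i + 1)), (f (i + 1), f i)}) =
        (\<Union>i\<in>range (\<lambda>i. i + t). {(f i, f (i + 1)), (f (i + 1), f i)})"
    by (simp only: surj_plus_right)
  also have "\<dots> = (\<Union>i. {(f (i + t), f (i + 1 + t)), (f (i + 1 + t), f (i + t))})"
    by (simp only: UN_simps(10) add.assoc add.commute[of 1 t])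
  finally show "parcs C = (\<Union>i. {(f (i + t), f (i + 1 + t)), (f (i + 1 + t), f (i + t))})"
    unfolding arcs_eq .
qed (use three_le in \<open>simp_all add: eq_iff_dvd mod_eq_dvd_iff\<close>)

text \<open>Running the cycle backwards turns negative displacements into positive ones, and a link
  given against the enumeration into one along it.\<close>

lemma reflect: "cyclic_enumeration C n (\<lambda>i. f (- i))"
proof
  show "pverts C = range (\<lambda>i. f (- i))"
    unfolding verts_eq by (auto simp: image_iff) (metis minus_minus)
  \<comment> \<open>Pair \<open>i\<close> of the reflected enumeration is pair
    \<open>- i - 1\<close> of the original one.\<close>
  have "surj (\<lambda>i::int. - i - 1)"
    by (rule surjI[of _ "\<lambda>i. - i - 1"]) simp
  then have "(\<Union>i. {(f i, f (i + 1)), (f (i + 1), f i)}) =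
        (\<Union>i\<in>range (\<lambda>i. - i - 1). {(f i, f (i + 1)), (f (i + 1), f i)})"
    by simp
  then show "parcs C = (\<Union>i. {(f (- i), f (- (i + 1))), (f (- (i + 1)), f (- i))})"
    unfolding arcs_eq by (simp add: insert_commute)
  show "f (- i) = f (- j) \<longleftrightarrow> i mod int n = j mod int n" for i j
  proof -
    have "int n dvd - i + j \<longleftrightarrow> int n dvd i - j"
      by (metis dvd_minus_iff minus_add_distrib minus_minus uminus_add_conv_diff add.commute)
    then show ?thesis by (simp add: eq_iff_dvd mod_eq_dvd_iff)
  qed
qed (fact three_le)

section \<open>Distance along the cycle as index displacement\<close>

text \<open>Every arc changes the index by \<open>1\<close> or \<open>-1\<close>. This bounds
  distances from below.\<close>

lemma awalk_displacement:
  assumes "pre_digraph.awalk (with_proj C) u p v" "u = f i"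
  shows "\<exists>s. v = f (i + s) \<and> \<bar>s\<bar> \<le> int (length p)"
proof -
  have "set p \<subseteq> parcs C" "pcas u p v"
    using assms(1) by (auto simp: pre_digraph.awalk_def cas_with_proj_eq)
  then show ?thesis using assms(2)
  proof (induction p arbitrary: u i)
    case Nil
    then show ?case by (intro exI[of _ 0]) simp
  next
    case (Cons e p)
    from Cons.prems(1) obtain k where
      "e = (f k, f (k + 1)) \<or> e = (f (k + 1), f k)"
      by (auto simp: arcs_eq)
    moreover have "fst e = f i" using Cons.prems by simp
    \<comment> \<open>The index \<open>k\<close> of the arc agrees with \<open>i\<close> only modulo
      \<open>n\<close>, so the unit step is carried over to \<open>i\<close> by periodicity.\<close>
    ultimately have "\<exists>\<delta>. \<bar>\<delta>\<bar> \<le> 1 \<and> snd e = f (i + \<delta>)"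
    proof (elim disjE)
      assume e: "e = (f k, f (k + 1))" "fst e = f i"
      then have "f (k + 1) = f (i + 1)" by (simp add: eq_iff_dvd)
      then show ?thesis using e by (intro exI[of _ 1]) simp
    next
      assume e: "e = (f (k + 1), f k)" "fst e = f i"
      then have "f k = f (i + (-1))" by (simp add: eq_iff_dvd algebra_simps)
      then show ?thesis using e by (intro exI[of _ "-1"]) simp
    qed
    then obtain \<delta> where \<delta>: "\<bar>\<delta>\<bar> \<le> 1" "snd e = f (i + \<delta>)" by blast
    obtain s where "v = f (i + \<delta> + s)" "\<bar>s\<bar> \<le> int (length p)"
      using Cons.IH[of "snd e" "i + \<delta>"] Cons.prems \<delta> by auto
    then show ?case using \<delta> by (intro exI[of _ "\<delta> + s"]) (simp add: add.assoc)
  qed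
qed

text \<open>The walk through the indices \<open>i\<close> to \<open>i + s\<close> visits
  \<open>s + 1\<close> indices of a single period and so repeats no node. This bounds distances from
  above.\<close>

lemma apath_forward:
  assumes "s < n"
  shows "\<exists>p. pre_digraph.apath (with_proj C) (f i) p (f (i + int s)) \<and> length p = s"
proof -
  define p where "p i s = map (\<lambda>k. (f (i + int k), f (i + int k + 1))) [0..<s]" for i s
  have p_Suc: "p i (Suc s) = (f i, f (i + 1)) # p (i + 1) s" for i s
    by (simp add: p_def upt_conv_Cons map_Suc_upt[symmetric] algebra_simps del: upt_Suc)
  have cas: "pcas (f i) (p i s) (f (i + int s))" for i s
  proof (induction s arbitrary: i)
    case (Suc s)
    then show ?case using Suc[of "i + 1"] by (simp add: p_Suc add.assoc)
  qed (simp add: p_def)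
  have verts: "pawalk_verts (f i) (p i s) = map (\<lambda>k. f (i + int k)) [0..<Suc s]" for i s
  proof (induction s arbitrary: i)
    case (Suc s)
    show ?case
      unfolding p_Suc upt_conv_Cons[OF zero_less_Suc, of "Suc s"]
      by (simp add: Suc map_Suc_upt[symmetric] algebra_simps del: upt_Suc)
  qed (simp add: p_def)
  have "inj_on (\<lambda>k. f (i + int k)) {0..<Suc s}"
  proof (rule inj_onI)
    fix k l
    assume "k \<in> {0..<Suc s}" "l \<in> {0..<Suc s}" "f (i + int k) = f (i + int l)"
    then show "k = l"
      using inj_onD[OF inj_on_atLeastLessThan[of "i + int n" i]] assms by force
  qed
  then have "distinct (pawalk_verts (f i) (p i s))"
    by (simp add: verts distinct_map del: upt_Suc)
  moreover have "set (p i s) \<subseteq> parcs C"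
    by (auto simp: p_def arcs_eq)
  ultimately have "pre_digraph.apath (with_proj C) (f i) (p i s) (f (i + int s))"
    using cas[of i s]
    by (auto simp: pre_digraph.apath_def pre_digraph.awalk_def cas_with_proj_eq
        awalk_verts_with_proj_eq verts_eq)
  then show ?thesis by (intro exI[of _ "p i s"]) (simp add: p_def)
qed

lemma apath_of_displacement:
  assumes "\<bar>s\<bar> < int n"
  shows "\<exists>p. pre_digraph.apath (with_proj C) (f i) p (f (i + s)) \<and> int (length p) = \<bar>s\<bar>"
proof (cases "0 \<le> s")
  case True
  then show ?thesis using apath_forward[of "nat s" i] assms by (auto simp: nat_less_iff)
next
  case False
  interpret R: cyclic_enumeration C n "\<lambda>i. f (- i)" by (rule reflect)
  show ?thesis using R.apath_forward[of "nat (- s)" "- i"] assms False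
    by (auto simp: nat_less_iff add.commute)
qed

text \<open>A shortest path displaces the index by at most its length, and a displacement
  \<open>s\<close> is realised by a path of length \<open>\<bar>s\<bar>\<close>. The bound on
  \<open>d\<close> keeps displacements below \<open>n\<close>, so a nonzero one leads to a different
  node.\<close>

lemma near_eq:
  assumes "2 * d < n"
  shows "near d C (f i) = (\<lambda>s. f (i + s)) ` ({- int d..int d} - {0})"
proof (intro equalityI subsetI)
  fix v assume v: "v \<in> near d C (f i)"
  then obtain j where j: "v = f j" by (auto simp: near_def verts_eq)
  \<comment> \<open>This displacement only shows that some path exists, so that the
    \<open>LEAST\<close> in \<open>cycle_dist\<close> is attained.\<close>
  have "\<bar>(j - i) mod int n\<bar> < int n" using three_le by simp
  from apath_of_displacement[OF this, of i]
  have "\<exists>m p. pre_digraph.apath (with_proj C) (f i) p v \<and> length p = m"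
    unfolding j by (auto simp: eq_iff mod_add_right_eq cong: conj_cong)
      (metis add.commute diff_add_cancel eq_iff mod_add_right_eq)
  from LeastI_ex[OF this] obtain p where
    p: "pre_digraph.apath (with_proj C) (f i) p v" "length p = cycle_dist C (f i) v"
    unfolding cycle_dist_def by blast
  then have "pre_digraph.awalk (with_proj C) (f i) p v"
    by (simp add: pre_digraph.apath_def)
  from awalk_displacement[OF this refl] obtain s where
    "v = f (i + s)" "\<bar>s\<bar> \<le> int (length p)" by blast
  with p(2) v show "v \<in> (\<lambda>s. f (i + s)) ` ({- int d..int d} - {0})"
    by (intro image_eqI[of _ _ s]) (auto simp: near_def)
next
  fix v assume "v \<in> (\<lambda>s. f (i + s)) ` ({- int d..int d} - {0})"
  then obtain s where s: "v = f (i + s)" "\<bar>s\<bar> \<le> int d" "s \<noteq> 0" by force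
  have sn: "\<bar>s\<bar> < int n" using s assms by linarith
  from apath_of_displacement[OF this, of i] obtain p where
    p: "pre_digraph.apath (with_proj C) (f i) p v" "int (length p) = \<bar>s\<bar>"
    unfolding s(1) by blast
  then have "cycle_dist C (f i) v \<le> length p"
    unfolding cycle_dist_def by (intro Least_le) blast
  moreover have "v \<noteq> f i"
    using sn s dvd_imp_le_int[of s "int n"] by (auto simp: eq_iff_dvd)
  ultimately show "v \<in> near d C (f i)"
    using p(2) s by (auto simp: near_def verts_eq)
qed

text \<open>The \<open>2 * d + 1\<close> indices from \<open>i - d\<close> to \<open>i + d\<close>
  fit into one period, so distinct displacements give distinct nodes.\<close>

lemma card_near:
  assumes "2 * d < n" "u \<in> pverts C"
  shows "card (near d C u) = 2 * d"
proof -
  obtain i where u: "u = f i" using assms(2) by (auto simp: verts_eq)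
  have "inj_on (\<lambda>s. f (i + s)) ({- int d..int d} - {0})"
  proof (rule inj_onI)
    fix s t
    assume "s \<in> {- int d..int d} - {0}" "t \<in> {- int d..int d} - {0}" "f (i + s) = f (i + t)"
    then show "s = t"
      using inj_onD[OF inj_on_atLeastLessThan[of "i - int d + int n" "i - int d"],
          of "i + s" "i + t"] assms(1) by force
  qed
  then show ?thesis by (simp add: u near_eq[OF assms(1)] card_image)
qed

section \<open>The initial ring network\<close>

lemma ring_network_sym:
  assumes "2 * d < n"
  shows "sym (parcs (ring_network d C))"
proof (rule symI)
  fix u v assume uv: "(u, v) \<in> parcs (ring_network d C)"
  then obtain i where i: "u = f i" by (auto simp: ring_network_def verts_eq)
  with uv have "v \<in> near d C (f i)" by (simp add: ring_network_def)
  then obtain s where s: "v = f (i + s)" "s \<in> {- int d..int d} - {0}"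
    unfolding near_eq[OF assms] by blast
  have "u = f (i + s + (- s))" by (simp add: i)
  then have "u \<in> near d C v"
    unfolding s(1) near_eq[OF assms] using s(2) by (intro image_eqI[of _ _ "- s"]) auto
  then show "(v, u) \<in> parcs (ring_network d C)"
    by (simp add: ring_network_def s(1) verts_eq)
qed

text \<open>Fewer than \<open>d\<close> deleted nodes between two survivors leave no gap that a link cannot
  bridge.\<close>

lemma ring_network_reach_along_arc:
  assumes "2 * d < n" "i \<le> j" "f i \<notin> S" "f j \<notin> S" "card ({i<..<j} \<inter> f -` S) < d"
  shows "(f i, f j) \<in> (Restr (parcs (ring_network d C)) (pverts C - S))\<^sup>*"
  using assms(2-5)
proof (induction "nat (j - i)" arbitrary: i rule: less_induct)
  case less
  let ?R = "Restr (parcs (ring_network d C)) (pverts C - S)"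
  have step: "(f i, f k) \<in> ?R" if "i < k" "k \<le> i + int d" "f k \<notin> S" for k
  proof -
    have "f k \<in> near d C (f i)"
      unfolding near_eq[OF assms(1)] using that by (intro image_eqI[of _ _ "k - i"]) auto
    then show ?thesis using that less.prems by (auto simp: ring_network_def verts_eq)
  qed
  consider "i = j" | "i < j" "j \<le> i + int d" | "i + int d < j" using less.prems by linarith
  then show ?case
  proof cases
    case 2
    then show ?thesis using step[of j] less.prems by blast
  next
    case 3
    \<comment> \<open>Otherwise the \<open>d\<close> indices after \<open>i\<close>, all strictly
      before \<open>j\<close>, would belong to deleted nodes, too many for this arc.\<close>
    have "\<exists>k\<in>{i<..i + int d}. f k \<notin> S"
    proof (rule ccontr)
      assume "\<not> ?thesis"
      then have "{i<..i + int d} \<subseteq> ({i<..<j} \<inter> f -` S)" using 3 by auto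
      from card_mono[OF _ this] show False using less.prems by simp
    qed
    then obtain k where k: "i < k" "k \<le> i + int d" "f k \<notin> S" by auto
    have "card ({k<..<j} \<inter> f -` S) \<le> card ({i<..<j} \<inter> f -` S)"
      using k by (intro card_mono) auto
    then have "(f k, f j) \<in> ?R\<^sup>*"
      using k 3 less.prems by (intro less.hyps) auto
    then show ?thesis using step[OF k] by (rule converse_rtrancl_into_rtrancl[rotated])
  qed simp
qed

text \<open>Two survivors cut one turn around the cycle into two arcs. Fewer than
  \<open>2 * d\<close> deletions leave fewer than \<open>d\<close> on one of them, and the survivors
  are joined along that arc; symmetry supplies the other direction.\<close>

lemma deletion_connected_ring_network:
  assumes "2 * d < n"
  shows "deletion_connected (2 * d) (ring_network d C)"
  unfolding deletion_connected_def
proof (intro allI impI ballI, elim conjE)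
  fix S u v
  let ?R = "Restr (parcs (ring_network d C)) (pverts C - S)"
  assume S: "finite S" "card S < 2 * d"
    and "u \<in> pverts (ring_network d C) - S" "v \<in> pverts (ring_network d C) - S"
  then have uv: "u \<in> pverts C" "v \<in> pverts C" "u \<notin> S" "v \<notin> S"
    by (auto simp: ring_network_def)
  obtain i where i: "u = f i" using uv by (auto simp: verts_eq)
  obtain j where j: "v = f j" "i \<le> j" "j < i + int n"
    using uv(2) unfolding verts_eq_image[of i] by auto
  \<comment> \<open>The second arc runs from \<open>j\<close> to the next occurrence of
    \<open>u\<close>, one period later.\<close>
  have u': "u = f (i + int n)" by (simp add: i eq_iff)
  let ?A = "({i<..<j} \<inter> f -` S)" and ?B = "({j<..<i + int n} \<inter> f -` S)"
  \<comment> \<open>Both arcs lie within one period, so each deleted node is counted at most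
    once.\<close>
  have "card ?A + card ?B = card (?A \<union> ?B)" by (subst card_Un_disjoint) auto
  also have "\<dots> = card (f ` (?A \<union> ?B))"
    using j by (intro card_image[symmetric]
        inj_on_subset[OF inj_on_atLeastLessThan[OF order.refl, of i]]) auto
  also have "\<dots> \<le> card S" by (intro card_mono S) auto
  finally have "card ?A < d \<or> card ?B < d" using S(2) by linarith
  then have "(u, v) \<in> ?R\<^sup>* \<or> (v, u) \<in> ?R\<^sup>*"
    using ring_network_reach_along_arc[OF assms, of i j S]
      ring_network_reach_along_arc[OF assms, of j "i + int n" S] uv i u' j by auto
  moreover have "sym (?R\<^sup>*)"
    using ring_network_sym[OF assms] by (intro sym_rtrancl) (auto simp: sym_def)
  ultimately show "(u, v) \<in> (Restr (parcs (ring_network d C)) (pverts (ring_network d C) - S))\<^sup>*"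
    by (auto simp: ring_network_def dest: symD)
qed

text \<open>Links are bounded by arcs, and each node has \<open>2 * d\<close> outgoing arcs by
  \<open>card_near\<close>.\<close>

lemma card_links_ring_network:
  assumes "2 * d < n"
  shows "card (links (ring_network d C)) \<le> n * (2 * d)"
proof -
  have parcs: "parcs (ring_network d C) = Sigma (pverts C) (near d C)"
    by (auto simp: ring_network_def)
  have fin: "finite (near d C u)" for u
    using finite_verts by (simp add: near_def)
  have "links (ring_network d C) = (\<lambda>(u, v). {u, v}) ` Sigma (pverts C) (near d C)"
    by (auto simp: links_def parcs)
  then have "card (links (ring_network d C)) \<le> card (Sigma (pverts C) (near d C))"
    using finite_verts fin by (simp only: card_image_le finite_SigmaI)
  also have "\<dots> = n * (2 * d)"
    using finite_verts fin card_near[OF assms] by (simp add: card_verts)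
  finally show ?thesis .
qed

section \<open>Subdividing a link\<close>

text \<open>The link between indices \<open>-1\<close> and \<open>0\<close> closes the period
  \<open>0\<close> to \<open>n - 1\<close>. The new node therefore takes index \<open>n\<close> of
  the longer period, and the earlier indices keep their nodes.\<close>

lemma subdivide_at_zero:
  assumes "x \<notin> pverts C"
  shows "\<exists>g. cyclic_enumeration (subdivide C (f (-1), f 0) x) (n + 1) g"
proof -
  define m where "m = int n + 1"
  have m: "m = int (n + 1)" "4 \<le> m" using three_le by (auto simp: m_def)
  define g where "g i = (if i mod m = int n then x else f (i mod m))" for i
  have x: "f i \<noteq> x" for i using assms by (auto simp: verts_eq)
  have r: "0 \<le> i mod m" "i mod m < m" for i using m by auto
  have g_small: "g i = f i" if "0 \<le> i" "i < int n" for i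
    using that by (simp add: g_def m_def)
  have g_n: "g (int n) = x" and g_m: "g m = f 0"
    using three_le by (simp_all add: g_def m_def)
  have g_mod: "g (i mod m) = g i" "g (i mod m + 1) = g (i + 1)" for i
    by (simp_all add: g_def mod_add_left_eq)
  have f_last: "f (int n - 1) = f (-1)" by (simp add: eq_iff_dvd)
  let ?E = "\<lambda>f i. {(f i, f (i + 1)), (f (i + 1), f i)}"
  have periodic_f: "(\<Union>i. ?E f i) = (\<Union>i\<in>{0..<int n}. ?E f i)"
  proof -
    have "?E f i = ?E f (i mod int n)" for i
    proof -
      have "f (i mod int n + 1) = f (i + 1)" by (simp add: eq_iff mod_add_left_eq)
      then show ?thesis by (simp add: f_mod)
    qed
    then show ?thesis using three_le by (intro UN_periodic) auto
  qed
  have periodic_g: "(\<Union>i. ?E g i) = (\<Union>i\<in>{0..<m}. ?E g i)"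
    using m(2) by (intro UN_periodic) (simp_all add: g_mod)
  \<comment> \<open>Pairs \<open>0\<close> to \<open>n - 2\<close> are common to both cycles. Pair
    \<open>n - 1\<close> of \<open>f\<close> is the subdivided link; pairs \<open>n - 1\<close> and
    \<open>n\<close> of \<open>g\<close> are its two halves.\<close>
  have split_f: "{0..<int n} = insert (int n - 1) {0..<int n - 1}"
    and split_g: "{0..<m} = insert (int n) (insert (int n - 1) {0..<int n - 1})"
    using three_le by (auto simp: m_def)
  have E_eq: "(\<Union>i\<in>{0..<int n - 1}. ?E g i) = (\<Union>i\<in>{0..<int n - 1}. ?E f i)"
    by (intro SUP_cong refl) (simp add: g_small)
  have not_removed: "?E f i \<inter> {(f (-1), f 0), (f 0, f (-1))} = {}"
    if "i \<in> {0..<int n - 1}" for i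
  proof -
    have inj: "k = l" if "f k = f l" "k \<in> {0..<int n}" "l \<in> {0..<int n}" for k l
      using that inj_onD[OF inj_on_atLeastLessThan[of "int n" 0]] by simp
    have "f i \<noteq> f (int n - 1)" "f 0 \<noteq> f (i + 1)"
      using that inj[of i "int n - 1"] inj[of 0 "i + 1"] by auto
    \<comment> \<open>Meeting the removed link in reverse would force \<open>i = 0\<close> and
      \<open>i + 1 = n - 1\<close>, hence \<open>n = 2\<close>, which \<open>three_le\<close>
      excludes.\<close>
    moreover have "f i \<noteq> f 0 \<or> f (i + 1) \<noteq> f (int n - 1)"
      using that inj[of i 0] inj[of "i + 1" "int n - 1"] three_le by auto
    ultimately show ?thesis unfolding f_last by auto
  qed
  have "parcs (subdivide C (f (-1), f 0) x) = (\<Union>i. ?E g i)"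
  proof -
    have "parcs C = {(f (-1), f 0), (f 0, f (-1))} \<union> (\<Union>i\<in>{0..<int n - 1}. ?E f i)"
      unfolding arcs_eq periodic_f split_f using f_last f_mod[of "int n"]
      by simp
    then have "parcs C - {(f (-1), f 0), (f 0, f (-1))} = (\<Union>i\<in>{0..<int n - 1}. ?E f i)"
      using not_removed by blast
    moreover have "(\<Union>i. ?E g i) =
        {(f (-1), x), (x, f (-1)), (x, f 0), (f 0, x)} \<union> (\<Union>i\<in>{0..<int n - 1}. ?E f i)"
      unfolding periodic_g split_g UN_insert E_eq using g_n g_m g_small[of "int n - 1"] three_le
      by (simp add: f_last m_def insert_commute)
    ultimately show ?thesis
      by (simp add: subdivide.simps)
  qed
  moreover have "pverts (subdivide C (f (-1), f 0) x) = range g"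
  proof -
    have "range g = g ` {0..<m}"
    proof -
      have "g i \<in> g ` {0..<m}" for i using g_mod(1)[of i] r[of i] by (metis atLeastLessThan_iff imageI)
      then show ?thesis by blast
    qed
    also have "{0..<m} = insert (int n) {0..<int n}" by (auto simp: m_def)
    also have "g ` \<dots> = insert x (f ` {0..<int n})"
      by (simp add: g_n) (metis (no_types, lifting) atLeastLessThan_iff g_small image_cong)
    finally show ?thesis using verts_eq_image[of 0] by simp
  qed
  moreover have "g i = g j \<longleftrightarrow> i mod m = j mod m" for i j
    using inj_onD[OF inj_on_atLeastLessThan[of "int n" 0], of "i mod m" "j mod m"] r[of i] r[of j]
      x[of "i mod m"] x[of "j mod m"] by (auto simp: g_def m_def)
  ultimately have "cyclic_enumeration (subdivide C (f (-1), f 0) x) (n + 1) g"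
    using three_le m(1) by unfold_locales auto
  then show ?thesis by blast
qed

text \<open>A rotation, preceded by a reflection if the link is given against the enumeration, moves
  \<open>a\<close> to index \<open>-1\<close> and \<open>b\<close> to index
  \<open>0\<close>.\<close>

lemma subdivide:
  assumes "x \<notin> pverts C" "(a, b) \<in> parcs C"
  shows "\<exists>g. cyclic_enumeration (subdivide C (a, b) x) (n + 1) g"
proof -
  obtain i where "a = f i \<and> b = f (i + 1) \<or> a = f (i + 1) \<and> b = f i"
    using assms(2) by (auto simp: arcs_eq)
  then show ?thesis
  proof (elim disjE conjE)
    assume ab: "a = f i" "b = f (i + 1)"
    interpret T: cyclic_enumeration C n "\<lambda>k. f (k + (i + 1))" by (rule shift)
    show ?thesis using T.subdivide_at_zero[OF assms(1)] by (simp add: ab)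
  next
    assume ab: "a = f (i + 1)" "b = f i"
    interpret R: cyclic_enumeration C n "\<lambda>k. f (- k)" by (rule reflect)
    interpret T: cyclic_enumeration C n "\<lambda>k. f (- (k + (- i)))" by (rule R.shift)
    show ?thesis using T.subdivide_at_zero[OF assms(1)] by (simp add: ab add.commute)
  qed
qed

end

section \<open>Enumerating a given cycle\<close>

lemma pawalk_verts_eq_Cons: "pcas u p v \<Longrightarrow> pawalk_verts u p = u # map snd p"
  by (induction p arbitrary: u) auto

lemma fst_nth_pcas: "pcas u p v \<Longrightarrow> k < length p \<Longrightarrow> fst (p ! k) = (u # map snd p) ! k"
proof (induction p arbitrary: u k)
  case (Cons e p)
  then show ?case by (cases k) auto
qed simp

lemma last_pcas: "pcas u p v \<Longrightarrow> last (u # map snd p) = v"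
  by (induction p arbitrary: u) auto

text \<open>Index \<open>i\<close> is sent to the start of arc number \<open>i mod n\<close> of the
  closed path \<open>p\<close>.\<close>

lemma cyclic_enumeration_of_cycle_graph:
  assumes "cycle_graph C"
  shows "\<exists>n f. cyclic_enumeration C n f"
proof -
  from assms obtain p u where p: "pcas u p u" "distinct (tl (pawalk_verts u p))"
    and len: "3 \<le> length p" and V: "pverts C = fst ` set p" and A: "parcs C = set p \<union> (set p)\<inverse>"
    by (auto simp: cycle_graph_def pre_digraph.cycle_def pre_digraph.awalk_def
        cas_with_proj_eq awalk_verts_with_proj_eq)
  define n where "n = length p"
  define f where "f i = fst (p ! nat (i mod int n))" for i
  have n: "3 \<le> n" using len n_def by simp
  have dist: "distinct (map snd p)"
    using p pawalk_verts_eq_Cons by fastforce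
  \<comment> \<open>Each arc ends where the next one starts; for the last arc this is the closedness
    of \<open>p\<close>.\<close>
  have snd_nth: "snd (p ! k) = fst (p ! (Suc k mod n))" if "k < n" for k
  proof (cases "Suc k < n")
    case True
    then show ?thesis using fst_nth_pcas[OF p(1), of "Suc k"] that by (simp add: n_def)
  next
    case False
    then have k: "Suc k = n" using that by simp
    then have "p ! k = last p" by (metis diff_Suc_1 last_conv_nth list.size(3) n_def nat.distinct(1))
    moreover have "p \<noteq> []" using n n_def by auto
    ultimately have "snd (p ! k) = u" using last_pcas[OF p(1)] by (simp add: last_map)
    then show ?thesis using k fst_nth_pcas[OF p(1), of 0] \<open>p \<noteq> []\<close> by (simp add: n_def)
  qed
  have f_succ: "f (i + 1) = snd (p ! nat (i mod int n))" for i
  proof -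
    have "nat (i mod int n) < n" using n by (simp add: nat_less_iff)
    moreover have "Suc (nat (i mod int n)) mod n = nat ((i + 1) mod int n)"
    proof -
      have "int (Suc (nat (i mod int n)) mod n) = (i + 1) mod int n"
        using n by (simp add: zmod_int mod_add_left_eq add.commute mod_add_right_eq)
      then show ?thesis by linarith
    qed
    ultimately show ?thesis by (simp add: snd_nth f_def)
  qed
  have nth_mem: "p ! nat (i mod int n) \<in> set p" for i
    using n by (intro nth_mem) (simp add: nat_less_iff flip: n_def)
  have set_p: "set p = range (\<lambda>i. (f i, f (i + 1)))"
  proof -
    have "e \<in> range (\<lambda>i. (f i, f (i + 1)))" if e: "e \<in> set p" for e
    proof -
      obtain k where "k < n" "e = p ! k" using e by (auto simp: in_set_conv_nth n_def)
      then have "e = (f (int k), f (int k + 1))"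
        unfolding f_succ by (simp add: f_def)
      then show ?thesis by blast
    qed
    moreover have "(f i, f (i + 1)) \<in> set p" for i
      unfolding f_succ using nth_mem[of i] by (simp add: f_def)
    ultimately show ?thesis by blast
  qed
  \<comment> \<open>Distinctness is known for the ends of arcs, which are the starts shifted by one;
    the shift is undone when the locale is established.\<close>
  have f_succ_eq: "f (i + 1) = f (j + 1) \<longleftrightarrow> i mod int n = j mod int n" for i j
  proof -
    have "nat (i mod int n) < length p" "nat (j mod int n) < length p"
      using n by (simp_all add: nat_less_iff flip: n_def)
    then have "f (i + 1) = f (j + 1) \<longleftrightarrow> nat (i mod int n) = nat (j mod int n)"
      unfolding f_succ using nth_eq_iff_index_eq[OF dist] by simp
    then show ?thesis using n by (simp add: eq_nat_nat_iff)
  qed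
  have "cyclic_enumeration C n f"
  proof
    show "f i = f j \<longleftrightarrow> i mod int n = j mod int n" for i j
      using f_succ_eq[of "i - 1" "j - 1"] by (simp add: mod_eq_dvd_iff)
    show "pverts C = range f" by (simp add: V set_p image_image)
    show "parcs C = (\<Union>i. {(f i, f (i + 1)), (f (i + 1), f i)})"
      unfolding A set_p by auto
  qed (fact n)
  then show ?thesis by blast
qed

section \<open>The growing sequence of networks\<close>

theorem theorem5:
  fixes Nf :: nat
    and G C :: "nat \<Rightarrow> 'a pair_pre_digraph"
  assumes "odd Nf" and "Nf > 0"
    and "\<And>k. k \<ge> 1 \<Longrightarrow> pair_graph (G k)"
    and "\<And>k. k \<ge> 2 \<Longrightarrow> card (pverts (G k)) = card (pverts (G (k - 1))) + 1"
    and "\<And>k. k \<ge> 1 \<Longrightarrow> Nf + 2 < card (pverts (G k))"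
    and "cycle_graph (C 1)"
    and "G 1 = ring_network ((Nf + 1) div 2) (C 1)"
    and "\<And>k. k \<ge> 2 \<Longrightarrow> growth_step ((Nf + 1) div 2) (C (k - 1)) (G (k - 1)) (C k) (G k)"
  shows "(\<forall>i j. 1 \<le> i \<and> i \<le> j \<longrightarrow> subgraph (with_proj (G i)) (with_proj (G j))) \<and>
         (\<forall>k\<ge>1. robust Nf (G k)) \<and>
         (\<forall>k\<ge>1. card (links (G k)) \<le> card (pverts (G k)) * (Nf + 1))"
proof -
  define d where "d = (Nf + 1) div 2"
  have d: "2 * d = Nf + 1" using assms(1) by (simp add: d_def)
  note steps = assms(8)[folded d_def]
  \<comment> \<open>The enumeration belongs to the invariant because the next step subdivides
    \<open>C k\<close> and needs the number of nodes near the new one.\<close>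
  have inv: "(\<exists>f. cyclic_enumeration (C k) (card (pverts (G k))) f) \<and> pverts (C k) = pverts (G k) \<and>
      deletion_connected (2 * d) (G k) \<and> card (links (G k)) \<le> card (pverts (G k)) * (2 * d)"
    if "1 \<le> k" for k
    using that
  proof (induction k rule: dec_induct)
    case base
    have V: "pverts (G 1) = pverts (C 1)" unfolding assms(7) by (simp add: ring_network_def)
    obtain n f where "cyclic_enumeration (C 1) n f"
      using cyclic_enumeration_of_cycle_graph[OF assms(6)] by blast
    then interpret cyclic_enumeration "C 1" n f .
    have n: "card (pverts (G 1)) = n" by (simp only: V card_verts)
    then have "2 * d < n" using assms(5)[of 1] d by simp
    then have "deletion_connected (2 * d) (G 1)" "card (links (G 1)) \<le> n * (2 * d)"
      unfolding assms(7) d_def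
      by (rule deletion_connected_ring_network card_links_ring_network)+
    then show ?case
      unfolding n using V cyclic_enumeration_axioms by blast
  next
    case (step k)
    let ?n = "card (pverts (G k))"
    from step obtain f where "cyclic_enumeration (C k) ?n f" by blast
    then interpret c: cyclic_enumeration "C k" ?n f .
    have "growth_step d (C k) (G k) (C (Suc k)) (G (Suc k))"
      using steps[of "Suc k"] step.hyps by simp
    then obtain x a b where x: "x \<notin> pverts (C k)" "(a, b) \<in> parcs (C k)"
      and C': "C (Suc k) = subdivide (C k) (a, b) x"
      and G': "G (Suc k) = attach x (near d (C (Suc k)) x) (G k)"
      by (rule growth_step_attachE)
    have n': "card (pverts (G (Suc k))) = ?n + 1" using assms(4)[of "Suc k"] step.hyps by simp
    obtain g where "cyclic_enumeration (C (Suc k)) (?n + 1) g"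
      using c.subdivide[OF x] C' by auto
    then interpret c': cyclic_enumeration "C (Suc k)" "?n + 1" g .
    let ?T = "near d (C (Suc k)) x"
    have V': "pverts (C (Suc k)) = pverts (G (Suc k))"
      using step.IH by (simp add: C' G' attach_def)
    \<comment> \<open>Nearness is measured on the new cycle, which has \<open>?n + 1\<close>
      nodes.\<close>
    have "2 * d < ?n + 1" using assms(5)[of k] step.hyps d by simp
    then have T: "card ?T = 2 * d" by (rule c'.card_near) (simp add: C')
    have T_sub: "?T \<subseteq> pverts (G k)"
      using step.IH by (auto simp: near_def C')
    have "deletion_connected (2 * d) (G (Suc k))"
      unfolding G' using step.IH T_sub T by (intro deletion_connected_attach) auto
    moreover have "card (links (G (Suc k))) \<le> (?n + 1) * (2 * d)"
    proof -
      have "finite (parcs (G k))" "finite (pverts (G k))"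
        using assms(3)[OF step.hyps(1)]
        by (auto simp: pair_graph_def pair_digraph_def pair_fin_digraph_def pair_fin_digraph_axioms_def)
      then have "card (links (G (Suc k))) \<le> card (links (G k)) + card ?T"
        unfolding G' using T_sub by (intro card_links_attach finite_links) (auto intro: finite_subset)
      \<comment> \<open>The extra node raises the bound by \<open>2 * d\<close>, which covers the
        new links.\<close>
      then show ?thesis using step.IH T by (simp add: algebra_simps)
    qed
    ultimately show ?case using c'.cyclic_enumeration_axioms V' n' by auto
  qed
  have "subgraph (with_proj (G i)) (with_proj (G j))" if "1 \<le> i" "i \<le> j" for i j
  proof -
    have "pverts (G i) \<subseteq> pverts (G j) \<and> parcs (G i) \<subseteq> parcs (G j)"
      using that(2)
    proof (induction j rule: dec_induct)
      case (step k)
      have "growth_step d (C k) (G k) (C (Suc k)) (G (Suc k))"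
        using steps[of "Suc k"] step.hyps that(1) by simp
      then show ?case by (rule growth_step_attachE) (use step.IH in \<open>auto simp: attach_def\<close>)
    qed simp
    \<comment> \<open>Besides inclusion, \<open>subgraph\<close> demands well-formedness of both
      digraphs.\<close>
    moreover have "wf_digraph (with_proj (G k))" if "1 \<le> k" for k
    proof -
      interpret pair_graph "G k" using assms(3)[OF that] .
      show ?thesis by unfold_locales
    qed
    ultimately show ?thesis using that by (auto simp: subgraph_def compatible_def)
  qed
  moreover have "robust Nf (G k)" if "1 \<le> k" for k
  proof (rule robust_of_deletion_connected)
    show "deletion_connected (Nf + 1) (G k)" using inv[OF that] d by simp
    show "Nf < card (pverts (G k))" using assms(5)[OF that] by simp
    \<comment> \<open>Infinite sets have cardinality \<open>0\<close>, so a positive cardinality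
      gives finiteness.\<close>
    then show "finite (pverts (G k))" by (simp add: card_ge_0_finite)
  qed
  moreover have "card (links (G k)) \<le> card (pverts (G k)) * (Nf + 1)" if "1 \<le> k" for k
    using inv[OF that] d by simp
  ultimately show ?thesis by blast
qed

end
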